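(* Assume $\operatorname{Ker}\Phi\cap\operatorname{Ker}D^*=\{0\}$ and fix $\lambda>0$. Then: (i) The $\lambda$-restricted transition space $\mathcal{H}_{\cdot,\lambda}=\{y\in\mathbb{R}^Q:(y,\lambda)\in\mathcal{H}\}$ has Lebesgue measure zero in $\mathbb{R}^Q$. (ii) For every $y\notin\mathcal{H}_{\cdot,\lambda}$, there exists a solution $x^\star$ of $(\mathcal{P}_\lambda(y))$ whose $D$-cosupport $J$ satisfies $(H_J)$, i.e. $\operatorname{Ker}\Phi\cap\mathcal{G}_J=\{0\}$. (iii) The mapping $y\mapsto\mu^\star_\lambda(y)$ is of class $C^\infty$ on $\mathbb{R}^Q\setminus\mathcal{H}_{\cdot,\lambda}$ (a set of full Lebesgue measure), and for $y\in\mathbb{R}^Q\setminus\mathcal{H}_{\cdot,\lambda}$ $$\frac{\partial\mu^\star_\lambda(y)}{\partial y}=\Phi A^{[J]}\Phi^*,$$ where $J$ is the $D$-cosupport of any solution of $(\mathcal{P}_\lambda(y))$ such that $(H_J)$ holds.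
   Context: $\Phi:\mathbb{R}^N\to\mathbb{R}^Q$ is a linear operator (a $Q\times N$ real matrix) and $D=(d_i)_{i=1}^P$ is a dictionary of $P$ atoms $d_i\in\mathbb{R}^N$, identified with the $N\times P$ matrix with columns $d_i$. $M^*$ is the adjoint (transpose) of $M$, $\operatorname{Id}$ the identity. For $y\in\mathbb{R}^Q$ and $\lambda>0$, $(\mathcal{P}_\lambda(y))$ is the problem of minimizing over $x\in\mathbb{R}^N$ the function $\frac12\|y-\Phi x\|_2^2+\lambda\|D^*x\|_1$; a solution is a global minimizer. All solutions of $(\mathcal{P}_\lambda(y))$ have the same image under $\Phi$, and $\mu^\star_\lambda(y)=\Phi x^\star$ denotes this common value, for any solution $x^\star$. $\partial\mu^\star_\lambda(y)/\partial y$ is the Jacobian matrix. $\mathbb{R}_+=[0,\infty)$. For $J\subset\{1,\dots,P\}$, $J^c$ is its complement, $D_J$ the submatrix of $D$ with columns indexed by $J$ (with $\operatorname{Im}D_\emptyset=\{0\}$). The $D$-support of $x$ is $I=\{i:(D^*x)_i\neq0\}$ and its $D$-cosupport is $J=I^c$. The cospace is $\mathcal{G}_J=\operatorname{Ker}D_J^*$ (equal to $\mathbb{R}^N$ if $J=\emptyset$). Condition $(H_J)$: $\operatorname{Ker}\Phi\cap\mathcal{G}_J=\{0\}$. When $(H_J)$ holds, $A^{[J]}=U_J(U_J^*\Phi^*\Phi U_J)^{-1}U_J^*$, where $U_J$ is a matrix whose columns form a basis of $\mathcal{G}_J$ (and $A^{[J]}=0$ if $\mathcal{G}_J=\{0\}$).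 Set $\tilde\Pi^{[J]}=\Phi^*(\Phi A^{[J]}\Phi^*-\operatorname{Id})$ and $\tilde\Omega^{[J]}=(\Phi^*\Phi A^{[J]}-\operatorname{Id})D_{J^c}$. $\operatorname{P}_{\mathcal{G}}$ denotes the orthogonal projector on a subspace $\mathcal{G}$. The transition space is $$\mathcal{H}=\bigcup_{J\subset\{1,\dots,P\},\,(H_J)\text{ holds}}\ \bigcup_{K\subset J,\ \operatorname{Im}\tilde\Pi^{[J]}\not\subseteq\operatorname{Im}D_{J\setminus K}}\ \bigcup_{s_{J^c}\in\{-1,1\}^{|J^c|}}\ \bigcup_{\sigma_K\in\{-1,1\}^{|K|}}\mathcal{H}_{J,K,s_{J^c},\sigma_K},$$ $$\mathcal{H}_{J,K,s_{J^c},\sigma_K}=\{(y,\lambda)\in\mathbb{R}^Q\times\mathbb{R}_+:\ \operatorname{P}_{\mathcal{G}_{J\setminus K}}\tilde\Pi^{[J]}y=\lambda\operatorname{P}_{\mathcal{G}_{J\setminus K}}(\tilde\Omega^{[J]}s_{J^c}-D_K\sigma_K)\}.$$ *)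

theory Defs
  imports "HOL-Analysis.Analysis"
begin

definition Ker :: "real^'n^'m \<Rightarrow> (real^'n) set" where
  "Ker M = {x. M *v x = 0}"

definition Img :: "real^'n^'m \<Rightarrow> (real^'m) set" where
  "Img M = range (\<lambda>x. M *v x)"

definition orth_proj :: "(real^'n) set \<Rightarrow> real^'n \<Rightarrow> real^'n" where
  "orth_proj G x = (THE p. p \<in> G \<and> (\<forall>v\<in>G. orthogonal (x - p) v))"

text \<open>The submatrix \<open>D\<^sub>J\<close> keeps the column type of \<open>D\<close>: the columns
  outside \<open>J\<close> are replaced by zero. Its image, the kernel of its transpose and its products
  with (zero-extended) vectors indexed by \<open>J\<close> are those of the true submatrix;
  in particular \<open>Img\<close> is \<open>{0}\<close> for \<open>J = {}\<close>.\<close>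

definition cols :: "real^'p^'n \<Rightarrow> 'p set \<Rightarrow> real^'p^'n" where
  "cols D J = (\<chi> i j. if j \<in> J then D $ i $ j else 0)"

definition cospace :: "real^'p^'n \<Rightarrow> 'p set \<Rightarrow> (real^'n) set" where
  "cospace D J = Ker (transpose (cols D J))"

definition D_support :: "real^'p^'n \<Rightarrow> real^'n \<Rightarrow> 'p set" where
  "D_support D x = {i. (transpose D *v x) $ i \<noteq> 0}"

definition D_cosupport :: "real^'p^'n \<Rightarrow> real^'n \<Rightarrow> 'p set" where
  "D_cosupport D x = - D_support D x"

definition H_cond :: "real^'n^'q \<Rightarrow> real^'p^'n \<Rightarrow> 'p set \<Rightarrow> bool" where
  "H_cond \<Phi> D J \<longleftrightarrow> Ker \<Phi> \<inter> cospace D J = {0}"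

definition objective ::
  "real^'n^'q \<Rightarrow> real^'p^'n \<Rightarrow> real \<Rightarrow> real^'q \<Rightarrow> real^'n \<Rightarrow> real" where
  "objective \<Phi> D lam y x =
     1 / 2 * (norm (y - \<Phi> *v x))\<^sup>2 + lam * (\<Sum>i\<in>UNIV. \<bar>(transpose D *v x) $ i\<bar>)"

definition is_solution ::
  "real^'n^'q \<Rightarrow> real^'p^'n \<Rightarrow> real \<Rightarrow> real^'q \<Rightarrow> real^'n \<Rightarrow> bool" where
  "is_solution \<Phi> D lam y x \<longleftrightarrow> (\<forall>z. objective \<Phi> D lam y x \<le> objective \<Phi> D lam y z)"

definition mu :: "real^'n^'q \<Rightarrow> real^'p^'n \<Rightarrow> real \<Rightarrow> real^'q \<Rightarrow> real^'q" where
  "mu \<Phi> D lam y = (THE m. \<exists>x. is_solution \<Phi> D lam y x \<and> m = \<Phi> *v x)"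

text \<open>The number of columns of a basis matrix \<open>U\<close> of \<open>\<G>\<^sub>J\<close> depends on \<open>J\<close>. Such a matrix is
  represented by the set \<open>B\<close> of its columns, which also serves as the index set of its columns:
  the column with index \<open>u \<in> B\<close> is \<open>u\<close>. A \<open>B \<times> B\<close> matrix is a function of two arguments,
  of which only the values on \<open>B\<close> matter.\<close>

definition inverse_on :: "'b set \<Rightarrow> ('b \<Rightarrow> 'b \<Rightarrow> real) \<Rightarrow> 'b \<Rightarrow> 'b \<Rightarrow> real" where
  "inverse_on B M = (SOME W. \<forall>u\<in>B. \<forall>v\<in>B.
     (\<Sum>w\<in>B. M u w * W w v) = (if u = v then 1 else 0) \<and>
     (\<Sum>w\<in>B. W u w * M w v) = (if u = v then 1 else 0))"

text \<open>\<open>U (U\<^sup>* \<Phi>\<^sup>* \<Phi> U)\<^sup>-\<^sup>1 U\<^sup>*\<close>, where the entry of \<open>U\<^sup>* \<Phi>\<^sup>* \<Phi> U\<close> at \<open>(u, v)\<close>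
  is \<open>(\<Phi> *v u) \<bullet> (\<Phi> *v v)\<close>.\<close>

definition A_of_basis :: "real^'n^'q \<Rightarrow> (real^'n) set \<Rightarrow> real^'n^'n" where
  "A_of_basis \<Phi> B = (\<chi> i j. \<Sum>u\<in>B. \<Sum>v\<in>B.
     u $ i * inverse_on B (\<lambda>u v. (\<Phi> *v u) \<bullet> (\<Phi> *v v)) u v * v $ j)"

text \<open>Only used when \<open>H_cond \<Phi> D J\<close> holds; the result then does not depend on the chosen basis,
  and it is \<open>0\<close> for the trivial cospace, whose basis is empty.\<close>

definition A_mat :: "real^'n^'q \<Rightarrow> real^'p^'n \<Rightarrow> 'p set \<Rightarrow> real^'n^'n" where
  "A_mat \<Phi> D J = A_of_basis \<Phi> (SOME B. independent B \<and> span B = cospace D J)"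

definition Pi_mat :: "real^'n^'q \<Rightarrow> real^'p^'n \<Rightarrow> 'p set \<Rightarrow> real^'q^'n" where
  "Pi_mat \<Phi> D J = transpose \<Phi> ** (\<Phi> ** A_mat \<Phi> D J ** transpose \<Phi> - mat 1)"

definition Omega_mat :: "real^'n^'q \<Rightarrow> real^'p^'n \<Rightarrow> 'p set \<Rightarrow> real^'p^'n" where
  "Omega_mat \<Phi> D J = (transpose \<Phi> ** \<Phi> ** A_mat \<Phi> D J - mat 1) ** cols D (- J)"

text \<open>A sign vector in \<open>{-1,1}\<^bsup>|J|\<^esup>\<close> is a vector over the full index type, constrained on \<open>J\<close> only;
  the other entries are always multiplied by zero columns.\<close>

definition sign_vectors :: "'p set \<Rightarrow> (real^'p) set" where
  "sign_vectors J = {s. \<forall>i\<in>J. s $ i \<in> {-1, 1}}"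

definition transition_piece ::
  "real^'n^'q \<Rightarrow> real^'p^'n \<Rightarrow> 'p set \<Rightarrow> 'p set \<Rightarrow> real^'p \<Rightarrow> real^'p \<Rightarrow> ((real^'q) \<times> real) set" where
  "transition_piece \<Phi> D J K s \<sigma> = {(y, lam). 0 \<le> lam \<and>
     orth_proj (cospace D (J - K)) (Pi_mat \<Phi> D J *v y) =
     lam *\<^sub>R orth_proj (cospace D (J - K)) (Omega_mat \<Phi> D J *v s - cols D K *v \<sigma>)}"

definition transition_space :: "real^'n^'q \<Rightarrow> real^'p^'n \<Rightarrow> ((real^'q) \<times> real) set" where
  "transition_space \<Phi> D =
     (\<Union>J\<in>{J. H_cond \<Phi> D J}.
      \<Union>K\<in>{K. K \<subseteq> J \<and> \<not> Img (Pi_mat \<Phi> D J) \<subseteq> Img (cols D (J - K))}.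
      \<Union>s\<in>sign_vectors (- J). \<Union>\<sigma>\<in>sign_vectors K. transition_piece \<Phi> D J K s \<sigma>)"

definition restricted_transition_space ::
  "real^'n^'q \<Rightarrow> real^'p^'n \<Rightarrow> real \<Rightarrow> (real^'q) set" where
  "restricted_transition_space \<Phi> D lam = {y. (y, lam) \<in> transition_space \<Phi> D}"

text \<open>\<open>Ck_on k S f\<close>, for open \<open>S\<close>: \<open>f\<close> is \<open>k\<close> times continuously differentiable on \<open>S\<close>. Iterating
  over directional derivatives, which have the same type as \<open>f\<close>, avoids spaces of multilinear
  maps.\<close>

primrec Ck_on ::
  "nat \<Rightarrow> 'a::euclidean_space set \<Rightarrow> ('a \<Rightarrow> 'b::euclidean_space) \<Rightarrow> bool" where
  "Ck_on 0 S f \<longleftrightarrow> continuous_on S f"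
| "Ck_on (Suc k) S f \<longleftrightarrow> (\<forall>x\<in>S. f differentiable (at x)) \<and>
     (\<forall>v. Ck_on k S (\<lambda>x. frechet_derivative f (at x) v))"

definition C_infinity_on ::
  "'a::euclidean_space set \<Rightarrow> ('a \<Rightarrow> 'b::euclidean_space) \<Rightarrow> bool" where
  "C_infinity_on S f \<longleftrightarrow> open S \<and> (\<forall>k. Ck_on k S f)"

end

theory Submission
  imports Defs
begin

text \<open>
  The problem is piecewise affine in \<open>y\<close>: as long as the cosupport of a solution and the signs on its
  support do not change, the solution solves a least-squares problem on the cospace, and its
  prediction is an affine function of \<open>y\<close> with linear part \<open>\<Phi> A \<Phi>\<^sup>*\<close>. The transition space collects the
  observations where the pattern may change.

  Optimality of \<open>x\<close> is equivalent to a dual certificate, a vector \<open>\<sigma>\<close> with entries in \<open>[-1, 1]\<close> that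
  agrees with the signs of \<open>D\<^sup>* x\<close> on the support and satisfies \<open>\<Phi>\<^sup>* (y - \<Phi> x) = lam D \<sigma>\<close>
  (\<open>is_solution_iff_certificate\<close>). Sufficiency comes with a quadratic gap, which yields uniqueness of
  the prediction (\<open>mu_eq\<close>). Necessity is a separation argument.

  Let \<open>x\<close> be a solution whose cosupport \<open>J\<close> satisfies \<open>(H\<^sub>J)\<close>; a solution of minimal support is one
  (\<open>H_cond_solution_exists\<close>). Let \<open>K \<subseteq> J\<close> be the set where \<open>\<bar>\<sigma>\<^sub>i\<bar> = 1\<close>. Moving \<open>y\<close> to \<open>z\<close> and \<open>x\<close> to
  \<open>x + A \<Phi>\<^sup>* (z - y)\<close> preserves \<open>D\<^sup>*\<^sub>J x = 0\<close> and, for \<open>z\<close> near \<open>y\<close>, the signs on the support. The equation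
  for \<open>\<sigma>\<close> acquires the error \<open>\<Pi> (z - y)\<close>, which can be absorbed by the entries of \<open>\<sigma>\<close> in \<open>J - K\<close>
  provided that \<open>Im \<Pi> \<subseteq> Im D\<^bsub>J - K\<^esub>\<close>. If this inclusion fails, the optimality condition projected onto
  the cospace of \<open>J - K\<close> says that \<open>y\<close> lies in the transition space. Hence off the transition space
  the displaced point is a solution (\<open>solution_near\<close>) and the prediction is affine near \<open>y\<close>
  (\<open>mu_affine_near\<close>), which gives smoothness and the Jacobian.

  The transition space is negligible and closed, being a finite union of affine subspaces, each of
  which is proper by the condition on the images (\<open>closed_negligible_restricted_transition_space\<close>).
  Closedness makes the complement open, as smoothness requires.
\<close>

section \<open>Cospaces, orthogonality and projections\<close>

text \<open>The library rewrites the product with a transpose to a row-vector product; the transposed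
  form is kept here because cospaces and analysis coefficients are stated with it.\<close>

declare transpose_matrix_vector [simp del]

lemma inner_matrix_transpose:
  fixes A :: "real^'a^'b"
  shows "(A *v x) \<bullet> y = x \<bullet> (transpose A *v y)"
  by (metis dot_lmul_matrix inner_commute transpose_matrix_vector)

lemma transpose_cols_mult_nth:
  "(transpose (cols D J) *v x) $ j = (if j \<in> J then (transpose D *v x) $ j else 0)"
  by (simp add: cols_def transpose_def matrix_vector_mult_def)

lemma cospace_iff: "x \<in> cospace D J \<longleftrightarrow> (\<forall>j\<in>J. (transpose D *v x) $ j = 0)"
  by (auto simp: cospace_def Ker_def vec_eq_iff transpose_cols_mult_nth)

lemma D_cosupport_iff: "j \<in> D_cosupport D x \<longleftrightarrow> (transpose D *v x) $ j = 0"
  by (simp add: D_cosupport_def D_support_def)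

lemma self_in_cospace_cosupport: "x \<in> cospace D (D_cosupport D x)"
  by (simp add: cospace_iff D_cosupport_iff)

lemma subspace_cospace: "subspace (cospace D J)"
  by (auto simp: subspace_def cospace_iff matrix_vector_right_distrib matrix_vector_mult_scaleR)

lemma cols_mult: "cols D J *v u = D *v (\<chi> j. if j \<in> J then u $ j else 0)"
  by (auto simp: cols_def matrix_vector_mult_def vec_eq_iff intro!: sum.cong)

lemma cospace_orthogonal_cols:
  assumes "v \<in> cospace D J"
  shows "v \<bullet> (cols D J *v u) = 0"
  using assms by (simp add: inner_commute[of v] inner_matrix_transpose cospace_def Ker_def)

text \<open>This inclusion \<open>(Ker M\<^sup>*)\<^sup>\<bottom> \<subseteq> Im M\<close> turns the failure of an inclusion of images, which
  qualifies a piece of the transition space, into a vector of the cospace that detects it.\<close>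

lemma orthogonal_Ker_transpose_imp_Img:
  assumes "\<And>v. v \<in> Ker (transpose M) \<Longrightarrow> v \<bullet> a = 0"
  shows "a \<in> Img M"
proof -
  have sub: "subspace (Img M)"
    unfolding Img_def by (simp add: linear_subspace_image)
  obtain p r where p: "p \<in> span (Img M)" and r: "\<And>w. w \<in> span (Img M) \<Longrightarrow> orthogonal r w"
    and a: "a = p + r"
    using orthogonal_subspace_decomp_exists[of "Img M" a] by metis
  have "transpose M *v r = 0"
  proof -
    have "(M *v x) \<bullet> r = 0" for x
      using r[of "M *v x"] by (simp add: Img_def span_base orthogonal_def inner_commute)
    then show ?thesis
      by (metis inner_matrix_transpose inner_eq_zero_iff)
  qed
  then have "r \<bullet> a = 0"
    using assms by (simp add: Ker_def)
  moreover have "r \<bullet> p = 0"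
    using r[OF p] by (simp add: orthogonal_def)
  ultimately have "r = 0"
    by (simp add: a inner_add_right)
  then show ?thesis
    using p a sub by (metis add.right_neutral span_eq_iff)
qed

lemma orth_proj_eqI:
  assumes "subspace G" "p \<in> G" "\<And>v. v \<in> G \<Longrightarrow> (x - p) \<bullet> v = 0"
  shows "orth_proj G x = p"
  unfolding orth_proj_def
proof (rule the_equality)
  show "p \<in> G \<and> (\<forall>v\<in>G. orthogonal (x - p) v)"
    using assms by (simp add: orthogonal_def)
next
  fix q assume q: "q \<in> G \<and> (\<forall>v\<in>G. orthogonal (x - q) v)"
  have "q - p \<in> G"
    using q assms by (simp add: subspace_diff)
  then have "(x - p) \<bullet> (q - p) = 0" "(x - q) \<bullet> (q - p) = 0"
    using q assms by (auto simp: orthogonal_def)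
  then have "(q - p) \<bullet> (q - p) = 0"
    by (simp add: inner_diff_left)
  then show "q = p" by simp
qed

lemma orth_proj_props:
  assumes "subspace G"
  shows "orth_proj G x \<in> G" "v \<in> G \<Longrightarrow> (x - orth_proj G x) \<bullet> v = 0"
proof -
  obtain p r where p: "p \<in> span G" and r: "\<And>w. w \<in> span G \<Longrightarrow> orthogonal r w"
    and x: "x = p + r"
    using orthogonal_subspace_decomp_exists[of G x] by metis
  have G: "span G = G" using assms by (simp add: span_eq_iff)
  have "orth_proj G x = p"
    by (rule orth_proj_eqI) (use assms p r x G in \<open>auto simp: orthogonal_def\<close>)
  then show "orth_proj G x \<in> G" "v \<in> G \<Longrightarrow> (x - orth_proj G x) \<bullet> v = 0"
    using p r x G by (auto simp: orthogonal_def)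
qed

text \<open>Projections are eliminated: the equation defining a piece of the transition space says that one
  affine function of the observation is orthogonal to the cospace. In this form the piece is an
  intersection of affine hyperplanes.\<close>

lemma orth_proj_eq_scaleR_iff:
  assumes "subspace G"
  shows "orth_proj G a = c *\<^sub>R orth_proj G b \<longleftrightarrow> (\<forall>v\<in>G. v \<bullet> (a - c *\<^sub>R b) = 0)" (is "?l \<longleftrightarrow> ?r")
proof
  assume l: ?l
  show ?r
  proof
    fix v assume "v \<in> G"
    then have "(a - orth_proj G a) \<bullet> v = 0" "(b - orth_proj G b) \<bullet> v = 0"
      using orth_proj_props(2)[OF assms] by blast+
    then show "v \<bullet> (a - c *\<^sub>R b) = 0"
      using l by (simp add: inner_commute[of v] inner_diff_left)
  qed
next
  assume r: ?r
  show ?l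
  proof (rule orth_proj_eqI[OF assms])
    show "c *\<^sub>R orth_proj G b \<in> G"
      by (simp add: assms orth_proj_props(1) subspace_scale)
    fix v assume v: "v \<in> G"
    then have "(b - orth_proj G b) \<bullet> v = 0" "(a - c *\<^sub>R b) \<bullet> v = 0"
      using orth_proj_props(2)[OF assms] r by (auto simp: inner_commute)
    then show "(a - c *\<^sub>R orth_proj G b) \<bullet> v = 0"
      by (simp add: inner_diff_left)
  qed
qed

section \<open>The matrix of the constrained least-squares problem\<close>

text \<open>The images of the basis vectors under \<open>\<Phi>\<close> are independent, since \<open>\<Phi>\<close> is injective on the span.
  The columns of the inverse are the coefficients of the dual basis inside the span of these
  images: the coordinate functionals, represented by vectors and projected onto the span. This is
  a right inverse; by symmetry of the Gram matrix its transpose is a left inverse, so the two agree.\<close>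

lemma gram_matrix_inverse_exists:
  fixes \<Phi> :: "real^'n^'q" and B :: "(real^'n) set"
  assumes B: "independent B" and inj: "Ker \<Phi> \<inter> span B = {0}"
  defines "M \<equiv> \<lambda>u v. (\<Phi> *v u) \<bullet> (\<Phi> *v v)"
  shows "\<exists>W. \<forall>u\<in>B. \<forall>v\<in>B.
     (\<Sum>w\<in>B. M u w * W w v) = (if u = v then 1 else 0) \<and>
     (\<Sum>w\<in>B. W u w * M w v) = (if u = v then 1 else 0)"
proof -
  have fin: "finite B"
    using B independent_imp_finite by blast
  have inj': "inj_on ((*v) \<Phi>) (span B)"
    by (rule linear_injective_on_subspace_0[THEN iffD2])
       (use inj in \<open>auto simp: Ker_def\<close>)
  have ind: "independent ((*v) \<Phi> ` B)"
    by (rule linear_independent_injective_image) (use B inj' in auto)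
  have injB: "inj_on ((*v) \<Phi>) B"
    using inj' inj_on_subset span_superset by blast
  have "\<exists>c. \<forall>u\<in>B. (\<Sum>w\<in>B. M u w * c w) = (if u = v then 1 else 0)" if "v \<in> B" for v
  proof -
    obtain f :: "real^'q \<Rightarrow> real" where f: "linear f"
      and fu: "\<forall>z\<in>(*v) \<Phi> ` B. f z = (if z = \<Phi> *v v then 1 else 0)"
      using linear_independent_extend[OF ind, of "\<lambda>z. if z = \<Phi> *v v then 1 else 0"] by blast
    obtain p r where p: "p \<in> span ((*v) \<Phi> ` B)"
      and r: "\<And>w. w \<in> span ((*v) \<Phi> ` B) \<Longrightarrow> orthogonal r w" and pr: "adjoint f 1 = p + r"
      using orthogonal_subspace_decomp_exists[of "(*v) \<Phi> ` B" "adjoint f 1"] by metis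
    obtain d where d: "p = (\<Sum>z\<in>(*v) \<Phi> ` B. d z *\<^sub>R z)"
      using p span_finite[of "(*v) \<Phi> ` B"] fin by auto
    then have d': "p = (\<Sum>w\<in>B. d (\<Phi> *v w) *\<^sub>R (\<Phi> *v w))"
      by (simp add: sum.reindex[OF injB])
    have "(\<Sum>w\<in>B. M u w * d (\<Phi> *v w)) = (if u = v then 1 else 0)" if "u \<in> B" for u
    proof -
      have "(\<Sum>w\<in>B. M u w * d (\<Phi> *v w)) = (\<Phi> *v u) \<bullet> p"
        by (simp add: d' inner_sum_right M_def mult.commute)
      also have "\<dots> = (\<Phi> *v u) \<bullet> adjoint f 1"
        using r[of "\<Phi> *v u"] that
        by (simp add: pr inner_add_right span_base orthogonal_def inner_commute)
      also have "\<dots> = f (\<Phi> *v u)"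
        using adjoint_works[OF f, of "\<Phi> *v u" 1] by simp
      also have "\<dots> = (if u = v then 1 else 0)"
        using fu that \<open>v \<in> B\<close> injB by (auto simp: inj_on_def)
      finally show ?thesis .
    qed
    then show ?thesis
      by (intro exI[of _ "\<lambda>w. d (\<Phi> *v w)"]) blast
  qed
  then obtain c where c: "\<And>u v. u \<in> B \<Longrightarrow> v \<in> B \<Longrightarrow> (\<Sum>w\<in>B. M u w * c v w) = (if u = v then 1 else 0)"
    by metis
  have sym: "M u v = M v u" for u v
    by (simp add: M_def inner_commute)
  have c_sym: "c u v = c v u" if "u \<in> B" "v \<in> B" for u v
  proof -
    have "c u v = (\<Sum>z\<in>B. (\<Sum>w\<in>B. M z w * c v w) * c u z)"
      using that fin by (simp add: c if_distrib[of "\<lambda>x. x * _"] sum.delta cong: if_cong)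
    also have "\<dots> = (\<Sum>w\<in>B. (\<Sum>z\<in>B. M w z * c u z) * c v w)"
      by (simp add: sum_distrib_right) (subst sum.swap, simp add: sym mult_ac)
    also have "\<dots> = c v u"
      using that fin by (simp add: c if_distrib[of "\<lambda>x. x * _"] sum.delta cong: if_cong)
    finally show ?thesis .
  qed
  have "(\<Sum>w\<in>B. c w u * M w v) = (if u = v then 1 else 0)" if "u \<in> B" "v \<in> B" for u v
  proof -
    have "(\<Sum>w\<in>B. c w u * M w v) = (\<Sum>w\<in>B. M v w * c u w)"
      by (rule sum.cong) (use that c_sym sym in \<open>auto simp: mult.commute\<close>)
    then show ?thesis using c[of v u] that by auto
  qed
  then show ?thesis
    using c by (intro exI[of _ "\<lambda>w v. c v w"]) blast
qed

lemma A_of_basis_mult: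
  "A_of_basis \<Phi> B *v z =
    (\<Sum>u\<in>B. (\<Sum>v\<in>B. inverse_on B (\<lambda>u v. (\<Phi> *v u) \<bullet> (\<Phi> *v v)) u v * (v \<bullet> z)) *\<^sub>R u)"
proof -
  let ?W = "inverse_on B (\<lambda>u v. (\<Phi> *v u) \<bullet> (\<Phi> *v v))"
  have "(A_of_basis \<Phi> B *v z) $ i = (\<Sum>u\<in>B. (\<Sum>v\<in>B. ?W u v * (v \<bullet> z)) *\<^sub>R u) $ i" for i
  proof -
    have "(A_of_basis \<Phi> B *v z) $ i
        = (\<Sum>j\<in>UNIV. \<Sum>u\<in>B. \<Sum>v\<in>B. u $ i * ?W u v * (v $ j * z $ j))"
      by (simp add: A_of_basis_def matrix_vector_mult_def sum_distrib_right mult.assoc)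
    also have "\<dots> = (\<Sum>u\<in>B. \<Sum>v\<in>B. \<Sum>j\<in>UNIV. u $ i * ?W u v * (v $ j * z $ j))"
      by (subst sum.swap, rule sum.cong[OF refl], rule sum.swap)
    also have "\<dots> = (\<Sum>u\<in>B. (\<Sum>v\<in>B. ?W u v * (v \<bullet> z)) *\<^sub>R u) $ i"
      by (simp add: inner_vec_def sum_distrib_left sum_distrib_right mult_ac)
    finally show ?thesis .
  qed
  then show ?thesis by (simp add: vec_eq_iff)
qed

lemma cospace_basis_exists:
  "\<exists>B. independent B \<and> span B = cospace D J"
  by (metis basis_exists span_eq_iff span_subspace subspace_cospace)

lemma A_mat_in_cospace: "A_mat \<Phi> D J *v z \<in> cospace D J"
proof -
  have "A_of_basis \<Phi> B *v z \<in> span B" for B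
    unfolding A_of_basis_mult by (intro span_sum span_scale span_base)
  then show ?thesis
    using someI_ex[OF cospace_basis_exists[of D J]] by (auto simp: A_mat_def)
qed

text \<open>Every summand of \<open>A\<close> ends with the inner product against a basis vector of the cospace; so \<open>A\<close>
  annihilates in particular the atoms indexed by \<open>J\<close>.\<close>

lemma A_mat_eq_0:
  assumes "\<And>v. v \<in> cospace D J \<Longrightarrow> v \<bullet> z = 0"
  shows "A_mat \<Phi> D J *v z = 0"
proof -
  define B where "B = (SOME B. independent B \<and> span B = cospace D J)"
  have "span B = cospace D J"
    using someI_ex[OF cospace_basis_exists[of D J]] by (simp add: B_def)
  then have "v \<bullet> z = 0" if "v \<in> B" for v
    using assms that span_base by blast
  then show ?thesis
    by (simp add: A_mat_def A_of_basis_mult flip: B_def)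
qed

text \<open>On the cospace \<open>A\<close> inverts the normal operator \<open>\<Phi>\<^sup>* \<Phi>\<close>. Together with the two lemmas above, this
  determines \<open>A\<close> without reference to a basis.\<close>

lemma A_mat_gram_cospace:
  assumes H: "H_cond \<Phi> D J" and x: "x \<in> cospace D J"
  shows "A_mat \<Phi> D J *v (transpose \<Phi> *v (\<Phi> *v x)) = x"
proof -
  define B where "B = (SOME B. independent B \<and> span B = cospace D J)"
  have B: "independent B" "span B = cospace D J"
    using someI_ex[OF cospace_basis_exists[of D J]] by (simp_all add: B_def)
  have fin: "finite B"
    using B independent_imp_finite by blast
  define M where "M = (\<lambda>u v. (\<Phi> *v u) \<bullet> (\<Phi> *v v))"
  have W: "(\<Sum>w\<in>B. inverse_on B M u w * M w v) = (if u = v then 1 else 0)"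
    if "u \<in> B" "v \<in> B" for u v
  proof -
    have "\<exists>W. \<forall>u\<in>B. \<forall>v\<in>B.
     (\<Sum>w\<in>B. M u w * W w v) = (if u = v then 1 else 0) \<and>
     (\<Sum>w\<in>B. W u w * M w v) = (if u = v then 1 else 0)"
      using gram_matrix_inverse_exists[of B \<Phi>] B H by (simp add: H_cond_def M_def)
    from someI_ex[OF this] show ?thesis
      using that unfolding inverse_on_def by blast
  qed
  obtain c where c: "x = (\<Sum>w\<in>B. c w *\<^sub>R w)"
    using x B(2) span_finite[OF fin] by auto
  have inner: "v \<bullet> (transpose \<Phi> *v (\<Phi> *v x)) = (\<Sum>w\<in>B. c w * M v w)" for v
    by (simp add: c M_def inner_sum_right matrix_vector_mult_scaleR
        linear_sum[OF matrix_vector_mul_linear] flip: inner_matrix_transpose)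
  have coeff: "(\<Sum>v\<in>B. inverse_on B M u v * (v \<bullet> (transpose \<Phi> *v (\<Phi> *v x)))) = c u"
    if "u \<in> B" for u
  proof -
    have "(\<Sum>v\<in>B. inverse_on B M u v * (v \<bullet> (transpose \<Phi> *v (\<Phi> *v x))))
        = (\<Sum>w\<in>B. c w * (\<Sum>v\<in>B. inverse_on B M u v * M v w))"
      by (simp add: inner sum_distrib_left) (subst sum.swap, simp add: mult_ac)
    also have "\<dots> = c u"
      using that fin by (simp add: W if_distrib[of "\<lambda>x. _ * x"] sum.delta cong: if_cong)
    finally show ?thesis .
  qed
  show ?thesis
    by (simp add: A_mat_def A_of_basis_mult coeff flip: B_def M_def) (simp add: c)
qed

section \<open>Dual certificates and uniqueness of the prediction\<close>

text \<open>The first-order optimality condition \<open>0 \<in> \<Phi>\<^sup>* (\<Phi> x - y) + lam D \<partial>\<parallel>\<cdot>\<parallel>\<^sub>1 (D\<^sup>* x)\<close>, with the subgradient as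
  an explicit vector: its entries are the signs of \<open>D\<^sup>* x\<close> on the support and arbitrary numbers in
  \<open>[-1, 1]\<close> on the cosupport.\<close>

definition dual_certificate ::
  "real^'n^'q \<Rightarrow> real^'p^'n \<Rightarrow> real \<Rightarrow> real^'q \<Rightarrow> real^'n \<Rightarrow> real^'p \<Rightarrow> bool" where
  "dual_certificate \<Phi> D lam y x \<sigma> \<longleftrightarrow>
     (\<forall>i. \<bar>\<sigma> $ i\<bar> \<le> 1 \<and> \<sigma> $ i * (transpose D *v x) $ i = \<bar>(transpose D *v x) $ i\<bar>) \<and>
     transpose \<Phi> *v (y - \<Phi> *v x) = lam *\<^sub>R (D *v \<sigma>)"

lemma dual_certificate_sgn:
  assumes "dual_certificate \<Phi> D lam y x \<sigma>" and "(transpose D *v x) $ i \<noteq> 0"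
  shows "\<sigma> $ i = sgn ((transpose D *v x) $ i)"
proof -
  have "\<sigma> $ i * (transpose D *v x) $ i = sgn ((transpose D *v x) $ i) * (transpose D *v x) $ i"
    using assms(1) by (simp add: dual_certificate_def abs_sgn mult.commute)
  then show ?thesis
    using assms(2) by simp
qed

text \<open>Sufficiency of the condition in a quantitative form: expanding the square and bounding the
  \<open>l\<^sub>1\<close> norm below by its subgradient leaves the quadratic term. This term makes all solutions
  have the same image under \<open>\<Phi>\<close>.\<close>

lemma dual_certificate_objective_gap:
  assumes cert: "dual_certificate \<Phi> D lam y x \<sigma>" and lam: "0 \<le> lam"
  shows "objective \<Phi> D lam y x + 1 / 2 * (norm (\<Phi> *v z - \<Phi> *v x))\<^sup>2 \<le> objective \<Phi> D lam y z"
proof -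
  let ?w = "transpose D *v x" and ?k = "transpose D *v z"
  have g: "(y - \<Phi> *v x) \<bullet> (\<Phi> *v z - \<Phi> *v x) = lam * (\<sigma> \<bullet> ?k - \<sigma> \<bullet> ?w)"
  proof -
    have "(y - \<Phi> *v x) \<bullet> (\<Phi> *v z - \<Phi> *v x) = (z - x) \<bullet> (transpose \<Phi> *v (y - \<Phi> *v x))"
      by (simp add: inner_commute[of "y - _"] flip: inner_matrix_transpose matrix_vector_mult_diff_distrib)
    also have "\<dots> = lam * ((D *v \<sigma>) \<bullet> (z - x))"
      using cert by (simp add: dual_certificate_def inner_commute)
    finally show ?thesis
      by (simp add: inner_matrix_transpose matrix_vector_mult_diff_distrib inner_diff_right)
  qed
  have w: "\<sigma> \<bullet> ?w = (\<Sum>i\<in>UNIV. \<bar>?w $ i\<bar>)"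
    using cert by (simp add: dual_certificate_def inner_vec_def)
  have k: "\<sigma> \<bullet> ?k \<le> (\<Sum>i\<in>UNIV. \<bar>?k $ i\<bar>)"
    unfolding inner_vec_def
  proof (rule sum_mono)
    fix i
    have "\<bar>\<sigma> $ i\<bar> * \<bar>?k $ i\<bar> \<le> 1 * \<bar>?k $ i\<bar>"
      using cert by (intro mult_right_mono) (auto simp: dual_certificate_def)
    then show "\<sigma> $ i \<bullet> ?k $ i \<le> \<bar>?k $ i\<bar>"
      by (simp add: abs_mult[symmetric])
  qed
  have "(norm (y - \<Phi> *v z))\<^sup>2 = (norm ((y - \<Phi> *v x) - (\<Phi> *v z - \<Phi> *v x)))\<^sup>2"
    by simp
  also have "\<dots> = (norm (y - \<Phi> *v x))\<^sup>2 + (norm (\<Phi> *v z - \<Phi> *v x))\<^sup>2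
      - 2 * ((y - \<Phi> *v x) \<bullet> (\<Phi> *v z - \<Phi> *v x))"
    unfolding power2_norm_eq_inner by (simp only: inner_diff inner_commute) (simp add: algebra_simps)
  finally have "(norm (y - \<Phi> *v z))\<^sup>2 = (norm (y - \<Phi> *v x))\<^sup>2 + (norm (\<Phi> *v z - \<Phi> *v x))\<^sup>2
      - 2 * (lam * (\<sigma> \<bullet> ?k - \<sigma> \<bullet> ?w))"
    by (simp only: g)
  moreover have "lam * (\<sigma> \<bullet> ?k) \<le> lam * (\<Sum>i\<in>UNIV. \<bar>?k $ i\<bar>)"
    using k lam by (rule mult_left_mono)
  ultimately show ?thesis
    unfolding objective_def by (simp add: w algebra_simps)
qed

text \<open>Necessity. The vectors \<open>lam D \<sigma>\<close> with \<open>\<sigma>\<close> an admissible subgradient form a compact convex set. If it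
  misses the correlation of the residual, a hyperplane separates the two, and the normal of the
  hyperplane is a direction of strict descent of the objective: the directional derivative of the
  \<open>l\<^sub>1\<close> norm is the maximum of \<open>\<sigma> \<bullet> D\<^sup>* h\<close> over the admissible \<open>\<sigma>\<close>.\<close>

lemma solution_has_certificate:
  fixes \<Phi> :: "real^'n^'q" and D :: "real^'p^'n"
  assumes sol: "is_solution \<Phi> D lam y x"
  shows "\<exists>\<sigma>. dual_certificate \<Phi> D lam y x \<sigma>"
proof (rule ccontr)
  assume no: "\<not> ?thesis"
  let ?w = "transpose D *v x"
  define S where "S = {\<sigma> :: real^'p. \<forall>i. \<bar>\<sigma> $ i\<bar> \<le> 1 \<and> \<sigma> $ i * ?w $ i = \<bar>?w $ i\<bar>}"
  define g where "g = transpose \<Phi> *v (y - \<Phi> *v x)"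
  define C where "C = (\<lambda>\<sigma>. lam *\<^sub>R (D *v \<sigma>)) ` S"
  have lin: "linear (\<lambda>\<sigma>. lam *\<^sub>R (D *v \<sigma>))"
    by (simp add: linear_compose_scale_right)
  have S: "S = (\<Inter>i. {\<sigma>. \<bar>\<sigma> $ i\<bar> \<le> 1} \<inter> {\<sigma>. \<sigma> $ i * ?w $ i = \<bar>?w $ i\<bar>})"
    by (auto simp: S_def)
  have "convex S"
  proof (rule convexI)
    fix a b :: "real^'p" and u v :: real
    assume a: "a \<in> S" and b: "b \<in> S" and uv: "0 \<le> u" "0 \<le> v" "u + v = 1"
    show "u *\<^sub>R a + v *\<^sub>R b \<in> S"
      unfolding S_def
    proof (intro CollectI allI conjI)
      fix i
      have "\<bar>u * a $ i + v * b $ i\<bar> \<le> u * \<bar>a $ i\<bar> + v * \<bar>b $ i\<bar>"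
        using uv by (metis abs_mult abs_of_nonneg abs_triangle_ineq)
      also have "\<dots> \<le> u * 1 + v * 1"
        using a b uv by (intro add_mono mult_left_mono) (auto simp: S_def)
      finally show "\<bar>(u *\<^sub>R a + v *\<^sub>R b) $ i\<bar> \<le> 1"
        using uv by simp
      have "(u *\<^sub>R a + v *\<^sub>R b) $ i * ?w $ i = u * (a $ i * ?w $ i) + v * (b $ i * ?w $ i)"
        by (simp add: algebra_simps)
      also have "\<dots> = (u + v) * \<bar>?w $ i\<bar>"
        using a b by (simp add: S_def algebra_simps)
      finally show "(u *\<^sub>R a + v *\<^sub>R b) $ i * ?w $ i = \<bar>?w $ i\<bar>"
        using uv by simp
    qed
  qed
  then have convC: "convex C"
    unfolding C_def by (rule convex_linear_image[OF lin])
  have "closed S"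
    unfolding S
    by (intro closed_INT ballI closed_Int closed_Collect_le closed_Collect_eq continuous_intros)
  moreover have "bounded S"
  proof (rule boundedI)
    fix \<sigma> assume "\<sigma> \<in> S"
    have "norm \<sigma> \<le> (\<Sum>i\<in>UNIV. \<bar>\<sigma> $ i\<bar>)"
      by (rule norm_le_l1_cart)
    also have "\<dots> \<le> (\<Sum>i\<in>(UNIV::'p set). 1)"
      using \<open>\<sigma> \<in> S\<close> by (intro sum_mono) (auto simp: S_def)
    finally show "norm \<sigma> \<le> (\<Sum>i\<in>(UNIV::'p set). 1)" .
  qed
  ultimately have "compact S"
    by (simp add: compact_eq_bounded_closed)
  then have "compact C"
    unfolding C_def by (intro compact_continuous_image linear_continuous_on linear_conv_bounded_linear[THEN iffD1] lin)
  then have closedC: "closed C"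
    by (rule compact_imp_closed)
  have "g \<notin> C"
    using no by (auto simp: C_def S_def g_def dual_certificate_def)
  then obtain a b where ag: "a \<bullet> g < b" and aC: "\<forall>c\<in>C. a \<bullet> c > b"
    using separating_hyperplane_closed_point[OF convC closedC] by blast
  define h where "h = - a"
  let ?k = "transpose D *v h"
  \<comment> \<open>The subgradient that maximizes the inner product with \<open>D\<^sup>* h\<close>.\<close>
  define \<sigma> :: "real^'p" where "\<sigma> = (\<chi> i. if ?w $ i = 0 then sgn (?k $ i) else sgn (?w $ i))"
  have "\<sigma> \<in> S"
    by (auto simp: S_def \<sigma>_def sgn_mult abs_sgn mult.commute abs_sgn_eq)
  then have "lam *\<^sub>R (D *v \<sigma>) \<in> C"
    unfolding C_def by (rule imageI)
  then have "a \<bullet> g < a \<bullet> (lam *\<^sub>R (D *v \<sigma>))"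
    using ag aC by force
  then have pos: "0 < g \<bullet> h - lam * (\<sigma> \<bullet> ?k)"
    by (simp add: h_def inner_commute inner_matrix_transpose[symmetric])
  define N where "N = (norm (\<Phi> *v h))\<^sup>2"
  have "\<forall>\<^sub>F t in at_right (0::real). \<bar>?w $ i + t * ?k $ i\<bar> = \<bar>?w $ i\<bar> + t * (\<sigma> $ i * ?k $ i)" for i
  proof (cases "?w $ i = 0")
    case True
    have "\<forall>\<^sub>F t in at_right (0::real). 0 < t"
      by (simp add: eventually_at_right_less)
    then show ?thesis
    proof eventually_elim
      case (elim t)
      then show ?case
        using True by (simp add: \<sigma>_def abs_mult) (simp add: abs_sgn mult.commute)
    qed
  next
    case False
    have "((\<lambda>t. \<bar>t * ?k $ i\<bar>) \<longlongrightarrow> \<bar>0 * ?k $ i\<bar>) (at_right (0::real))"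
      by (intro tendsto_intros)
    then have "\<forall>\<^sub>F t in at_right (0::real). \<bar>t * ?k $ i\<bar> < \<bar>?w $ i\<bar>"
      using False by (auto intro: order_tendstoD)
    then show ?thesis
    proof eventually_elim
      case (elim t)
      then show ?case
        using False by (auto simp: \<sigma>_def sgn_if abs_if split: if_splits)
    qed
  qed
  then have "\<forall>\<^sub>F t in at_right (0::real). \<forall>i. \<bar>?w $ i + t * ?k $ i\<bar> = \<bar>?w $ i\<bar> + t * (\<sigma> $ i * ?k $ i)"
    by (simp add: eventually_all_finite)
  moreover have "\<forall>\<^sub>F t in at_right (0::real). t * N / 2 < g \<bullet> h - lam * (\<sigma> \<bullet> ?k)"
  proof -
    have "((\<lambda>t. t * N / 2) \<longlongrightarrow> 0 * N / 2) (at_right (0::real))"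
      by (intro tendsto_intros) auto
    then show ?thesis
      by (rule order_tendstoD(2)) (use pos in simp)
  qed
  moreover have "\<forall>\<^sub>F t in at_right (0::real). 0 < t"
    by (simp add: eventually_at_right_less)
  ultimately have "\<forall>\<^sub>F t in at_right (0::real). False"
  proof eventually_elim
    case (elim t)
    have "(\<Sum>i\<in>UNIV. \<bar>(transpose D *v (x + t *\<^sub>R h)) $ i\<bar>)
        = (\<Sum>i\<in>UNIV. \<bar>?w $ i\<bar> + t * (\<sigma> $ i * ?k $ i))"
      using elim by (simp add: matrix_vector_right_distrib matrix_vector_mult_scaleR)
    also have "\<dots> = (\<Sum>i\<in>UNIV. \<bar>?w $ i\<bar>) + t * (\<sigma> \<bullet> ?k)"
      by (simp add: sum.distrib inner_vec_def sum_distrib_left)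
    finally have l1: "(\<Sum>i\<in>UNIV. \<bar>(transpose D *v (x + t *\<^sub>R h)) $ i\<bar>)
        = (\<Sum>i\<in>UNIV. \<bar>?w $ i\<bar>) + t * (\<sigma> \<bullet> ?k)" .
    have gh: "g \<bullet> h = (y - \<Phi> *v x) \<bullet> (\<Phi> *v h)"
      unfolding g_def by (metis inner_commute inner_matrix_transpose)
    have "y - \<Phi> *v (x + t *\<^sub>R h) = (y - \<Phi> *v x) - t *\<^sub>R (\<Phi> *v h)"
      by (simp add: matrix_vector_right_distrib matrix_vector_mult_scaleR)
    then have "(norm (y - \<Phi> *v (x + t *\<^sub>R h)))\<^sup>2
        = (norm (y - \<Phi> *v x))\<^sup>2 - 2 * t * (g \<bullet> h) + t * t * N"
      unfolding power2_norm_eq_inner N_def gh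
      by (simp add: inner_diff_left inner_diff_right inner_commute algebra_simps)
    then have "objective \<Phi> D lam y (x + t *\<^sub>R h)
        = objective \<Phi> D lam y x + t * (t * N / 2 - (g \<bullet> h - lam * (\<sigma> \<bullet> ?k)))"
      unfolding objective_def l1 by (simp add: algebra_simps)
    also have "\<dots> < objective \<Phi> D lam y x"
      using elim by (simp add: mult_pos_neg)
    finally show False
      using sol by (force simp: is_solution_def not_less[symmetric])
  qed
  then show False by simp
qed

lemma is_solution_iff_certificate:
  assumes "0 \<le> lam"
  shows "is_solution \<Phi> D lam y x \<longleftrightarrow> (\<exists>\<sigma>. dual_certificate \<Phi> D lam y x \<sigma>)"
proof
  assume "\<exists>\<sigma>. dual_certificate \<Phi> D lam y x \<sigma>"
  then obtain \<sigma> where \<sigma>: "dual_certificate \<Phi> D lam y x \<sigma>" ..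
  show "is_solution \<Phi> D lam y x"
    unfolding is_solution_def
  proof
    fix z
    show "objective \<Phi> D lam y x \<le> objective \<Phi> D lam y z"
      using dual_certificate_objective_gap[OF \<sigma> assms, of z]
        zero_le_power2[of "norm (\<Phi> *v z - \<Phi> *v x)"] by linarith
  qed
qed (rule solution_has_certificate)

lemma mu_eq:
  assumes lam: "0 \<le> lam" and x: "is_solution \<Phi> D lam y x"
  shows "mu \<Phi> D lam y = \<Phi> *v x"
  unfolding mu_def
proof (rule the_equality)
  show "\<exists>x'. is_solution \<Phi> D lam y x' \<and> \<Phi> *v x = \<Phi> *v x'"
    using x by blast
next
  fix m assume "\<exists>z. is_solution \<Phi> D lam y z \<and> m = \<Phi> *v z"
  then obtain z where z: "is_solution \<Phi> D lam y z" "m = \<Phi> *v z" by blast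
  obtain \<sigma> where "dual_certificate \<Phi> D lam y x \<sigma>"
    using x solution_has_certificate by blast
  then have "objective \<Phi> D lam y x + 1 / 2 * (norm (\<Phi> *v z - \<Phi> *v x))\<^sup>2 \<le> objective \<Phi> D lam y z"
    using lam by (rule dual_certificate_objective_gap)
  moreover have "objective \<Phi> D lam y z \<le> objective \<Phi> D lam y x"
    using z by (simp add: is_solution_def)
  ultimately have "(norm (\<Phi> *v z - \<Phi> *v x))\<^sup>2 \<le> 0"
    by linarith
  then show "m = \<Phi> *v x"
    using z by simp
qed

section \<open>Solutions whose cospace meets the kernel trivially\<close>

lemma continuous_on_matrix_vector_mult [continuous_intros]:
  fixes A :: "real^'a^'b"
  assumes "continuous_on S f"
  shows "continuous_on S (\<lambda>x. A *v f x)"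
  by (rule bounded_linear.continuous_on[OF matrix_vector_mul_bounded_linear assms])

text \<open>Sublevel sets bound both \<open>\<Phi> x\<close> and \<open>D\<^sup>* x\<close>, and the joint map is injective by the assumption on the
  kernels; so sublevel sets are bounded and the minimum is attained.\<close>

lemma solution_exists:
  fixes \<Phi> :: "real^'n^'q" and D :: "real^'p^'n"
  assumes ker: "Ker \<Phi> \<inter> Ker (transpose D) = {0}" and lam: "lam > 0"
  shows "\<exists>x. is_solution \<Phi> D lam y x"
proof -
  let ?T = "\<lambda>x. (\<Phi> *v x, transpose D *v x)"
  have lin: "linear ?T"
    by (intro linearI) (simp_all add: matrix_vector_right_distrib matrix_vector_mult_scaleR)
  have "inj ?T"
    using ker by (auto simp: linear_injective_0[OF lin] Ker_def zero_prod_def)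
  then obtain b where b: "b > 0" "\<And>x. b * norm x \<le> norm (?T x)"
    using linear_inj_bounded_below_pos[OF lin] by metis
  define m where "m = objective \<Phi> D lam y 0"
  \<comment> \<open>The radius outside of which the objective exceeds its value at 0.\<close>
  define R where "R = (norm y + sqrt (2 * m) + m / lam) / b"
  have m: "0 \<le> m"
    by (simp add: m_def objective_def)
  have R: "0 \<le> R"
    using b m lam by (simp add: R_def)
  have bound: "norm x \<le> R" if le: "objective \<Phi> D lam y x \<le> m" for x
  proof -
    let ?w = "transpose D *v x"
    have pos: "0 \<le> lam * (\<Sum>i\<in>UNIV. \<bar>?w $ i\<bar>)"
      using lam by (simp add: sum_nonneg)
    then have "(norm (y - \<Phi> *v x))\<^sup>2 \<le> 2 * m"
      using le by (simp add: objective_def)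
    then have 1: "norm (y - \<Phi> *v x) \<le> sqrt (2 * m)"
      by (rule real_le_rsqrt)
    have "lam * (\<Sum>i\<in>UNIV. \<bar>?w $ i\<bar>) \<le> m"
      using le zero_le_power2[of "norm (y - \<Phi> *v x)"] unfolding objective_def by linarith
    then have "(\<Sum>i\<in>UNIV. \<bar>?w $ i\<bar>) \<le> m / lam"
      using lam by (simp add: field_simps)
    then have 2: "norm ?w \<le> m / lam"
      using norm_le_l1_cart[of ?w] by linarith
    have "norm (\<Phi> *v x) \<le> norm y + norm (y - \<Phi> *v x)"
      by (metis add.commute norm_minus_commute norm_triangle_sub)
    then have "b * norm x \<le> norm y + sqrt (2 * m) + m / lam"
      using b(2)[of x] norm_Pair_le[of "\<Phi> *v x" ?w] 1 2 by linarith
    then show ?thesis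
      using b by (simp add: R_def field_simps)
  qed
  have "continuous_on (cball 0 R) (objective \<Phi> D lam y)"
    unfolding objective_def by (intro continuous_intros)
  then obtain x where x: "\<And>z. z \<in> cball 0 R \<Longrightarrow> objective \<Phi> D lam y x \<le> objective \<Phi> D lam y z"
    using continuous_attains_inf[of "cball 0 R" "objective \<Phi> D lam y"] R
    by (metis ball_eq_empty cball_eq_empty compact_cball not_less)
  have "objective \<Phi> D lam y x \<le> objective \<Phi> D lam y z" for z
  proof (cases "objective \<Phi> D lam y z \<le> m")
    case True
    then show ?thesis using bound x by simp
  next
    case False
    then show ?thesis using x[of 0] R by (simp add: m_def)
  qed
  then show ?thesis
    by (auto simp: is_solution_def)
qed

text \<open>A nonzero \<open>h\<close> in \<open>Ker \<Phi>\<close> and in the cospace is a direction along which the fidelity term is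
  constant and the zero entries of \<open>D\<^sup>* x\<close> stay zero. As long as no sign on the support changes, the
  certificate of \<open>x\<close> remains valid; stopping when the first entry vanishes shrinks the support.\<close>

lemma smaller_support_if_not_H_cond:
  fixes \<Phi> :: "real^'n^'q" and D :: "real^'p^'n"
  assumes ker: "Ker \<Phi> \<inter> Ker (transpose D) = {0}" and lam: "0 \<le> lam"
    and x: "is_solution \<Phi> D lam y x" and H: "\<not> H_cond \<Phi> D (D_cosupport D x)"
  shows "\<exists>x'. is_solution \<Phi> D lam y x' \<and> D_support D x' \<subset> D_support D x"
proof -
  let ?w = "transpose D *v x"
  have "0 \<in> Ker \<Phi> \<inter> cospace D (D_cosupport D x)"
    by (simp add: Ker_def cospace_def)
  then obtain h where h: "h \<noteq> 0" "\<Phi> *v h = 0" "h \<in> cospace D (D_cosupport D x)"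
    using H by (auto simp: H_cond_def Ker_def)
  let ?k = "transpose D *v h"
  have k0: "?k $ i = 0" if "?w $ i = 0" for i
    using h(3) that by (simp add: cospace_iff D_cosupport_iff)
  have "?k \<noteq> 0"
    using h ker by (auto simp: Ker_def)
  then have ne: "{i. ?k $ i \<noteq> 0} \<noteq> {}"
    by (auto simp: vec_eq_iff)
  obtain i where i: "?k $ i \<noteq> 0"
    and min: "\<And>j. ?k $ j \<noteq> 0 \<Longrightarrow> \<bar>?w $ i / ?k $ i\<bar> \<le> \<bar>?w $ j / ?k $ j\<bar>"
    using ex_min_if_finite[of "(\<lambda>j. \<bar>?w $ j / ?k $ j\<bar>) ` {i. ?k $ i \<noteq> 0}"] ne
    by (auto simp: not_less)
  \<comment> \<open>The step of least modulus that annihilates an entry of the support.\<close>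
  define t where "t = - ?w $ i / ?k $ i"
  define x' where "x' = x + t *\<^sub>R h"
  have w': "(transpose D *v x') $ j = ?w $ j + t * ?k $ j" for j
    by (simp add: x'_def matrix_vector_right_distrib matrix_vector_mult_scaleR)
  have small: "\<bar>t * ?k $ j\<bar> \<le> \<bar>?w $ j\<bar>" for j
  proof (cases "?k $ j = 0")
    case False
    then show ?thesis
      using min[OF False] by (simp add: t_def abs_mult field_simps)
  qed simp
  obtain \<sigma> where \<sigma>: "dual_certificate \<Phi> D lam y x \<sigma>"
    using x solution_has_certificate by blast
  have "\<Phi> *v x' = \<Phi> *v x"
    by (simp add: x'_def matrix_vector_right_distrib matrix_vector_mult_scaleR h)
  moreover have "\<sigma> $ j * (transpose D *v x') $ j = \<bar>(transpose D *v x') $ j\<bar>" for j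
  proof (cases "?w $ j = 0")
    case True
    then show ?thesis using k0 by (simp add: w')
  next
    case False
    then have "\<sigma> $ j = sgn (?w $ j)"
      using \<sigma> dual_certificate_sgn by blast
    then show ?thesis
      using small[of j] unfolding w' by (auto simp: sgn_if abs_if split: if_splits)
  qed
  ultimately have "dual_certificate \<Phi> D lam y x' \<sigma>"
    using \<sigma> by (simp add: dual_certificate_def)
  then have "is_solution \<Phi> D lam y x'"
    using lam is_solution_iff_certificate by blast
  moreover have "D_support D x' \<subseteq> D_support D x"
    using k0 by (auto simp: D_support_def w')
  moreover have "i \<in> D_support D x" "i \<notin> D_support D x'"
    using i k0 by (auto simp: D_support_def w' t_def)
  ultimately show ?thesis
    by blast
qed

lemma H_cond_solution_exists:
  fixes \<Phi> :: "real^'n^'q" and D :: "real^'p^'n"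
  assumes ker: "Ker \<Phi> \<inter> Ker (transpose D) = {0}" and lam: "lam > 0"
  shows "\<exists>x. is_solution \<Phi> D lam y x \<and> H_cond \<Phi> D (D_cosupport D x)"
proof -
  obtain x where x: "is_solution \<Phi> D lam y x"
    and min: "\<And>z. is_solution \<Phi> D lam y z \<Longrightarrow> card (D_support D x) \<le> card (D_support D z)"
    using ex_has_least_nat[of "is_solution \<Phi> D lam y" _ "\<lambda>x. card (D_support D x)"]
      solution_exists[OF assms] by blast
  have "H_cond \<Phi> D (D_cosupport D x)"
  proof (rule ccontr)
    assume "\<not> ?thesis"
    then obtain x' where "is_solution \<Phi> D lam y x'" "D_support D x' \<subset> D_support D x"
      using smaller_support_if_not_H_cond[OF ker _ x] lam by auto
    then show False
      using min[of x'] psubset_card_mono[of "D_support D x" "D_support D x'"] by simp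
  qed
  then show ?thesis using x by blast
qed

section \<open>The transition space is closed and negligible\<close>

text \<open>A piece of the transition space at a fixed parameter, with the projections removed.\<close>

definition transition_slice ::
  "real^'n^'q \<Rightarrow> real^'p^'n \<Rightarrow> real \<Rightarrow> 'p set \<Rightarrow> 'p set \<Rightarrow> real^'p \<Rightarrow> real^'p \<Rightarrow> (real^'q) set" where
  "transition_slice \<Phi> D lam J K s \<sigma> = {y. \<forall>v\<in>cospace D (J - K).
     v \<bullet> (Pi_mat \<Phi> D J *v y - lam *\<^sub>R (Omega_mat \<Phi> D J *v s - cols D K *v \<sigma>)) = 0}"

lemma transition_piece_iff_slice:
  assumes "0 \<le> lam"
  shows "(y, lam) \<in> transition_piece \<Phi> D J K s \<sigma> \<longleftrightarrow> y \<in> transition_slice \<Phi> D lam J K s \<sigma>"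
  using assms
  by (simp add: transition_piece_def transition_slice_def orth_proj_eq_scaleR_iff[OF subspace_cospace])

lemma closed_transition_slice: "closed (transition_slice \<Phi> D lam J K s \<sigma>)"
proof -
  have "transition_slice \<Phi> D lam J K s \<sigma> = (\<Inter>v\<in>cospace D (J - K). {y.
     v \<bullet> (Pi_mat \<Phi> D J *v y - lam *\<^sub>R (Omega_mat \<Phi> D J *v s - cols D K *v \<sigma>)) = 0})"
    by (auto simp: transition_slice_def)
  also have "closed \<dots>"
    by (intro closed_INT ballI closed_Collect_eq continuous_intros)
  finally show ?thesis .
qed

text \<open>If the image of \<open>\<Pi>\<close> is not contained in \<open>Im D\<^bsub>J - K\<^esub>\<close>, some vector \<open>v\<close> of the cospace has \<open>\<Pi>\<^sup>* v \<noteq> 0\<close>,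
  and the slice lies in a hyperplane with this normal.\<close>

lemma negligible_transition_slice:
  assumes "\<not> Img (Pi_mat \<Phi> D J) \<subseteq> Img (cols D (J - K))"
  shows "negligible (transition_slice \<Phi> D lam J K s \<sigma>)"
proof -
  obtain z where "Pi_mat \<Phi> D J *v z \<notin> Img (cols D (J - K))"
    using assms by (auto simp: Img_def)
  then obtain v where v: "v \<in> cospace D (J - K)" "v \<bullet> (Pi_mat \<Phi> D J *v z) \<noteq> 0"
    using orthogonal_Ker_transpose_imp_Img[of "cols D (J - K)"] unfolding cospace_def by blast
  define c where "c = v \<bullet> (lam *\<^sub>R (Omega_mat \<Phi> D J *v s - cols D K *v \<sigma>))"
  let ?a = "transpose (Pi_mat \<Phi> D J) *v v"
  have a: "v \<bullet> (Pi_mat \<Phi> D J *v y) = ?a \<bullet> y" for y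
    by (simp add: inner_commute[of v] inner_commute[of ?a] inner_matrix_transpose)
  have "?a \<noteq> 0"
    using v(2) a[of z] by auto
  then have "negligible {y. ?a \<bullet> y = c}"
    by (intro negligible_hyperplane disjI1)
  moreover have "transition_slice \<Phi> D lam J K s \<sigma> \<subseteq> {y. ?a \<bullet> y = c}"
    using v(1) by (auto simp: transition_slice_def c_def inner_diff_right simp flip: a)
  ultimately show ?thesis
    by (rule negligible_subset)
qed

lemma finite_sign_vectors_UNIV: "finite (sign_vectors (UNIV :: 'p::finite set))"
proof -
  have "s \<in> range (\<lambda>A. \<chi> i. if i \<in> A then 1 else -1)" if "s \<in> sign_vectors UNIV" for s :: "real^'p"
    by (rule image_eqI[of _ _ "{i. s $ i = 1}"])
       (use that in \<open>auto simp: sign_vectors_def vec_eq_iff\<close>)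
  then have "sign_vectors (UNIV :: 'p set) \<subseteq> range (\<lambda>A. \<chi> i. if i \<in> A then 1 else -1)"
    by blast
  then show ?thesis
    by (rule finite_subset) simp
qed

text \<open>Sign vectors are unconstrained outside their index set, so there may be infinitely many of
  them. Only the constrained entries matter for the products, whence finitely many representatives suffice.\<close>

lemma sign_vector_extension:
  assumes "s \<in> sign_vectors J"
  shows "\<exists>s'\<in>sign_vectors UNIV. cols D J *v s' = cols D J *v s"
proof
  show "(\<chi> i. if i \<in> J then s $ i else 1) \<in> sign_vectors UNIV"
    using assms by (simp add: sign_vectors_def)
  show "cols D J *v (\<chi> i. if i \<in> J then s $ i else 1) = cols D J *v s"
    unfolding cols_mult by (rule arg_cong[of _ _ "(*v) D"]) (simp add: vec_eq_iff)
qed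

lemma restricted_transition_space_iff:
  assumes "0 \<le> lam"
  shows "y \<in> restricted_transition_space \<Phi> D lam \<longleftrightarrow> (\<exists>J K s \<sigma>. H_cond \<Phi> D J \<and> K \<subseteq> J \<and>
    \<not> Img (Pi_mat \<Phi> D J) \<subseteq> Img (cols D (J - K)) \<and> s \<in> sign_vectors (- J) \<and>
    \<sigma> \<in> sign_vectors K \<and> y \<in> transition_slice \<Phi> D lam J K s \<sigma>)"
  unfolding restricted_transition_space_def transition_space_def UN_iff Bex_def mem_Collect_eq
    transition_piece_iff_slice[OF assms]
  by (simp only: ex_simps simp_thms conj_assoc)

lemma restricted_transition_space_eq_UN_slices:
  assumes "0 \<le> lam"
  shows "restricted_transition_space \<Phi> D lam =
    (\<Union>(J, K, s, \<sigma>)\<in>{(J, K, s, \<sigma>). H_cond \<Phi> D J \<and> K \<subseteq> J \<and>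
        \<not> Img (Pi_mat \<Phi> D J) \<subseteq> Img (cols D (J - K)) \<and>
        s \<in> sign_vectors UNIV \<and> \<sigma> \<in> sign_vectors UNIV}. transition_slice \<Phi> D lam J K s \<sigma>)"
    (is "?l = ?r")
proof
  show "?r \<subseteq> ?l"
  proof
    fix y assume "y \<in> ?r"
    then obtain J K s \<sigma> where *: "H_cond \<Phi> D J" "K \<subseteq> J"
        "\<not> Img (Pi_mat \<Phi> D J) \<subseteq> Img (cols D (J - K))"
      and "s \<in> sign_vectors UNIV" "\<sigma> \<in> sign_vectors UNIV"
      and y: "y \<in> transition_slice \<Phi> D lam J K s \<sigma>"
      by blast
    then have "s \<in> sign_vectors (- J)" "\<sigma> \<in> sign_vectors K"
      by (simp_all add: sign_vectors_def)
    then show "y \<in> ?l"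
      unfolding restricted_transition_space_iff[OF assms]
      by (intro exI[of _ J] exI[of _ K] exI[of _ s] exI[of _ \<sigma>] conjI * y)
  qed
  show "?l \<subseteq> ?r"
  proof
    fix y assume "y \<in> ?l"
    then obtain J K s \<sigma> where *: "H_cond \<Phi> D J" "K \<subseteq> J"
        "\<not> Img (Pi_mat \<Phi> D J) \<subseteq> Img (cols D (J - K))"
      and s: "s \<in> sign_vectors (- J)" and \<sigma>: "\<sigma> \<in> sign_vectors K"
      and y: "y \<in> transition_slice \<Phi> D lam J K s \<sigma>"
      unfolding restricted_transition_space_iff[OF assms] by (elim exE conjE)
    obtain s' where s': "s' \<in> sign_vectors UNIV" "cols D (- J) *v s' = cols D (- J) *v s"
      using sign_vector_extension[OF s] by blast
    obtain \<sigma>' where \<sigma>': "\<sigma>' \<in> sign_vectors UNIV" "cols D K *v \<sigma>' = cols D K *v \<sigma>"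
      using sign_vector_extension[OF \<sigma>] by blast
    have "Omega_mat \<Phi> D J *v s' = Omega_mat \<Phi> D J *v s"
      by (simp add: Omega_mat_def s' flip: matrix_vector_mul_assoc)
    then have "y \<in> transition_slice \<Phi> D lam J K s' \<sigma>'"
      using y by (simp add: transition_slice_def \<sigma>')
    then show "y \<in> ?r"
      using * s' \<sigma>' by blast
  qed
qed

lemma closed_negligible_restricted_transition_space:
  fixes \<Phi> :: "real^'n^'q" and D :: "real^'p^'n"
  assumes "0 \<le> lam"
  shows "closed (restricted_transition_space \<Phi> D lam)"
    and "negligible (restricted_transition_space \<Phi> D lam)"
proof -
  let ?I = "{(J, K, s :: real^'p, \<sigma> :: real^'p). H_cond \<Phi> D J \<and> K \<subseteq> J \<and>
        \<not> Img (Pi_mat \<Phi> D J) \<subseteq> Img (cols D (J - K)) \<and>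
        s \<in> sign_vectors UNIV \<and> \<sigma> \<in> sign_vectors UNIV}"
  have fin': "finite (UNIV \<times> UNIV \<times> sign_vectors UNIV \<times> sign_vectors UNIV
      :: ('p set \<times> 'p set \<times> (real^'p) \<times> (real^'p)) set)"
    by (intro finite_cartesian_product finite_sign_vectors_UNIV) simp_all
  have fin: "finite ?I"
    by (rule finite_subset[OF _ fin']) auto
  show "closed (restricted_transition_space \<Phi> D lam)"
    unfolding restricted_transition_space_eq_UN_slices[OF assms]
    by (rule closed_UN[OF fin]) (auto simp: closed_transition_slice)
  show "negligible (restricted_transition_space \<Phi> D lam)"
    unfolding restricted_transition_space_eq_UN_slices[OF assms]
    by (rule negligible_Union) (use fin in \<open>auto intro!: negligible_transition_slice\<close>)
qed

section \<open>Following a solution when the observation moves\<close>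

text \<open>A solution with cosupport \<open>J\<close> satisfies \<open>x = A (\<Phi>\<^sup>* y - lam D \<sigma>)\<close>, by applying \<open>A\<close> to the optimality
  condition. Substituting this back shows that \<open>\<Pi> y\<close> is determined by the certificate. The remainder lies in
  \<open>Im D\<^bsub>J - K\<^esub>\<close>, hence is orthogonal to the cospace of \<open>J - K\<close>. When \<open>K\<close> consists of
  the indices at which \<open>\<sigma>\<close> is saturated, \<open>\<sigma>\<close> is a sign vector there and this is the equation of
  a piece of the transition space.\<close>

lemma Pi_mat_at_solution:
  fixes \<Phi> :: "real^'n^'q" and D :: "real^'p^'n"
  assumes cert: "dual_certificate \<Phi> D lam y x \<sigma>"
    and J: "J = D_cosupport D x" and H: "H_cond \<Phi> D J" and K: "K \<subseteq> J"
  shows "Pi_mat \<Phi> D J *v y - lam *\<^sub>R (Omega_mat \<Phi> D J *v \<sigma> - cols D K *v \<sigma>)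
    = - lam *\<^sub>R (cols D (J - K) *v \<sigma>)"
proof -
  let ?A = "A_mat \<Phi> D J"
  have split: "D *v \<sigma> = cols D (- J) *v \<sigma> + cols D K *v \<sigma> + cols D (J - K) *v \<sigma>"
    unfolding cols_mult matrix_vector_right_distrib[symmetric]
    by (rule arg_cong[of _ _ "(*v) D"]) (use K in \<open>auto simp: vec_eq_iff\<close>)
  have "?A *v (cols D L *v \<sigma>) = 0" if "L \<subseteq> J" for L
    using that by (intro A_mat_eq_0 cospace_orthogonal_cols) (auto simp: cospace_iff)
  then have AD: "?A *v (D *v \<sigma>) = ?A *v (cols D (- J) *v \<sigma>)"
    using K by (simp add: split matrix_vector_right_distrib)
  have grad: "transpose \<Phi> *v y = transpose \<Phi> *v (\<Phi> *v x) + lam *\<^sub>R (D *v \<sigma>)"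
    using cert by (simp add: dual_certificate_def matrix_vector_mult_diff_distrib algebra_simps)
  have "?A *v (transpose \<Phi> *v (\<Phi> *v x)) = x"
    by (rule A_mat_gram_cospace[OF H]) (simp add: J self_in_cospace_cosupport)
  then have Ay: "?A *v (transpose \<Phi> *v y) = x + lam *\<^sub>R (?A *v (cols D (- J) *v \<sigma>))"
    by (simp add: grad matrix_vector_right_distrib matrix_vector_mult_scaleR AD)
  have Pi: "Pi_mat \<Phi> D J *v y = transpose \<Phi> *v (\<Phi> *v (?A *v (transpose \<Phi> *v y))) - transpose \<Phi> *v y"
    by (simp add: Pi_mat_def matrix_vector_mult_diff_rdistrib matrix_vector_mult_diff_distrib
        flip: matrix_vector_mul_assoc)
  have Om: "Omega_mat \<Phi> D J *v \<sigma>
      = transpose \<Phi> *v (\<Phi> *v (?A *v (cols D (- J) *v \<sigma>))) - cols D (- J) *v \<sigma>"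
    by (simp add: Omega_mat_def matrix_vector_mult_diff_rdistrib flip: matrix_vector_mul_assoc)
  show ?thesis
    unfolding Pi Om Ay
    by (simp add: grad split matrix_vector_right_distrib matrix_vector_mult_scaleR algebra_simps)
qed

text \<open>Let \<open>K\<close> be the saturated part of the cosupport. By the previous lemma \<open>y\<close> satisfies the equation of
  the piece of \<open>J\<close>, \<open>K\<close> and the signs of \<open>\<sigma>\<close>; since \<open>y\<close> is off the transition space, this piece does
  not qualify, that is, \<open>Im \<Pi> \<subseteq> Im D\<^bsub>J - K\<^esub>\<close>. When the observation moves to \<open>z\<close> and the solution moves
  with \<open>A\<close>, the optimality condition is violated by \<open>\<Pi> (z - y)\<close>. By the inclusion this error is
  absorbed by a small change of the unsaturated entries of \<open>\<sigma>\<close>, which have room to move.\<close>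

lemma solution_near:
  fixes \<Phi> :: "real^'n^'q" and D :: "real^'p^'n"
  assumes lam: "lam > 0" and y: "y \<notin> restricted_transition_space \<Phi> D lam"
    and x: "is_solution \<Phi> D lam y x" and H: "H_cond \<Phi> D (D_cosupport D x)"
  defines "A \<equiv> A_mat \<Phi> D (D_cosupport D x)"
  shows "\<exists>U. open U \<and> y \<in> U \<and>
    (\<forall>z\<in>U. is_solution \<Phi> D lam z (x + A *v (transpose \<Phi> *v (z - y))))"
proof -
  define J where "J = D_cosupport D x"
  let ?w = "transpose D *v x"
  obtain \<sigma> where cert: "dual_certificate \<Phi> D lam y x \<sigma>"
    using x solution_has_certificate by blast
  then have \<sigma>1: "\<bar>\<sigma> $ i\<bar> \<le> 1" for i
    by (simp add: dual_certificate_def)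
  have \<sigma>_sgn: "\<sigma> $ i = sgn (?w $ i)" if "i \<notin> J" for i
    using dual_certificate_sgn[OF cert] that by (simp add: J_def D_cosupport_iff)
  define K where "K = {i\<in>J. \<bar>\<sigma> $ i\<bar> = 1}"
  have KJ: "K \<subseteq> J" by (auto simp: K_def)
  have "\<sigma> \<in> sign_vectors (- J)" "\<sigma> \<in> sign_vectors K"
    by (auto simp: sign_vectors_def \<sigma>_sgn K_def sgn_if J_def D_cosupport_iff abs_if split: if_splits)
  moreover have "y \<in> transition_slice \<Phi> D lam J K \<sigma> \<sigma>"
    using Pi_mat_at_solution[OF cert J_def _ KJ] H
    by (simp add: transition_slice_def J_def[symmetric] cospace_orthogonal_cols)
  ultimately have "Img (Pi_mat \<Phi> D J) \<subseteq> Img (cols D (J - K))"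
    using y H KJ lam
    by (auto simp: restricted_transition_space_def transition_space_def transition_piece_iff_slice
        J_def[symmetric])
  moreover obtain g where g: "linear g"
    "\<And>z. z \<in> Img (cols D (J - K)) \<Longrightarrow> cols D (J - K) *v g z = z"
    using linear_exists_right_inverse_on[OF matrix_vector_mul_linear subspace_UNIV, of "cols D (J - K)"]
    by (auto simp: Img_def)
  ultimately have g_Pi: "cols D (J - K) *v g (Pi_mat \<Phi> D J *v d) = Pi_mat \<Phi> D J *v d" for d
    by (auto simp: Img_def)
  define X where "X z = x + A *v (transpose \<Phi> *v (z - y))" for z
  \<comment> \<open>The corrected certificate; \<open>g\<close> chooses a preimage of the error linearly, so that the
    correction is small for \<open>z\<close> near \<open>y\<close>.\<close>
  define S :: "real^'q \<Rightarrow> real^'p" where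
    "S z = \<sigma> - (1 / lam) *\<^sub>R (\<chi> j. if j \<in> J - K then g (Pi_mat \<Phi> D J *v (z - y)) $ j else 0)" for z
  have cont_X: "continuous_on UNIV (\<lambda>z. (transpose D *v X z) $ i)" for i
    unfolding X_def by (intro continuous_intros)
  have cont_S: "continuous_on UNIV (\<lambda>z. \<sigma> $ i - (1 / lam) * g (Pi_mat \<Phi> D J *v (z - y)) $ i)" for i
    by (intro continuous_intros bounded_linear.continuous_on[OF linear_conv_bounded_linear[THEN iffD1, OF g(1)]])
  \<comment> \<open>The first family keeps the signs on the support, the second keeps the unsaturated entries of
    the certificate unsaturated.\<close>
  define U where "U = (\<Inter>i\<in>- J. {z. \<bar>(transpose D *v X z) $ i - ?w $ i\<bar> < \<bar>?w $ i\<bar>}) \<inter>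
    (\<Inter>i\<in>J - K. {z. \<bar>\<sigma> $ i - (1 / lam) * g (Pi_mat \<Phi> D J *v (z - y)) $ i\<bar> < 1})"
  have "open U"
    unfolding U_def
    by (intro open_Int open_INT ballI open_Collect_less continuous_intros cont_X cont_S) simp_all
  moreover have "y \<in> U"
    using \<sigma>1 linear_0[OF g(1)]
    by (auto simp: U_def X_def J_def D_cosupport_iff K_def less_le)
  moreover have "is_solution \<Phi> D lam z (X z)" if "z \<in> U" for z
  proof -
    have "X z \<in> cospace D J"
      unfolding X_def A_def J_def
      by (intro subspace_add subspace_cospace A_mat_in_cospace self_in_cospace_cosupport)
    then have XJ: "(transpose D *v X z) $ i = 0" if "i \<in> J" for i
      using that by (simp add: cospace_iff)
    have "\<bar>S z $ i\<bar> \<le> 1 \<and> S z $ i * (transpose D *v X z) $ i = \<bar>(transpose D *v X z) $ i\<bar>" for i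
    proof (cases "i \<in> J")
      case True
      then show ?thesis
        using \<sigma>1[of i] \<open>z \<in> U\<close> by (auto simp: XJ S_def U_def less_imp_le)
    next
      case False
      then have "\<bar>(transpose D *v X z) $ i - ?w $ i\<bar> < \<bar>?w $ i\<bar>"
        using \<open>z \<in> U\<close> by (auto simp: U_def)
      then show ?thesis
        using False by (auto simp: S_def \<sigma>_sgn sgn_if abs_if split: if_splits)
    qed
    moreover have "transpose \<Phi> *v (z - \<Phi> *v X z) = lam *\<^sub>R (D *v S z)"
    proof -
      have "transpose \<Phi> *v (z - \<Phi> *v X z)
          = transpose \<Phi> *v (y - \<Phi> *v x) - Pi_mat \<Phi> D J *v (z - y)"
        by (simp add: X_def A_def J_def[symmetric] Pi_mat_def matrix_vector_mult_diff_rdistrib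
            matrix_vector_mult_diff_distrib matrix_vector_right_distrib algebra_simps
            flip: matrix_vector_mul_assoc)
      also have "transpose \<Phi> *v (y - \<Phi> *v x) = lam *\<^sub>R (D *v \<sigma>)"
        using cert by (simp add: dual_certificate_def)
      also have "lam *\<^sub>R (D *v \<sigma>) - Pi_mat \<Phi> D J *v (z - y) = lam *\<^sub>R (D *v S z)"
      proof -
        define d where "d = z - y"
        have "D *v S z = D *v \<sigma> - (1 / lam) *\<^sub>R (Pi_mat \<Phi> D J *v d)"
          unfolding S_def d_def[symmetric] matrix_vector_mult_diff_distrib matrix_vector_mult_scaleR
            cols_mult[symmetric] g_Pi ..
        then show ?thesis
          using lam by (simp add: scaleR_diff_right flip: d_def)
      qed
      finally show ?thesis .
    qed
    ultimately have "dual_certificate \<Phi> D lam z (X z) (S z)"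
      by (simp add: dual_certificate_def)
    then show ?thesis
      using lam is_solution_iff_certificate less_imp_le by blast
  qed
  ultimately show ?thesis
    unfolding X_def by blast
qed

section \<open>Smoothness of locally affine maps\<close>

lemma affine_near_has_derivative:
  fixes f :: "'a::euclidean_space \<Rightarrow> 'b::euclidean_space"
  assumes "open U" "x \<in> U" "linear L" and f: "\<And>z. z \<in> U \<Longrightarrow> f z = c + L z"
  shows "(f has_derivative L) (at x)"
proof (rule has_derivative_transform_within_open)
  show "((\<lambda>z. c + L z) has_derivative L) (at x)"
    using linear_imp_has_derivative[OF assms(3)] has_derivative_add[OF has_derivative_const] by force
qed (use assms in auto)

text \<open>The directional derivatives of a locally affine map are locally constant, hence again locally
  affine.\<close>

lemma locally_affine_imp_Ck_on:
  fixes f :: "'a::euclidean_space \<Rightarrow> 'b::euclidean_space"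
  assumes "\<And>x. x \<in> S \<Longrightarrow> \<exists>U c L. open U \<and> x \<in> U \<and> linear L \<and> (\<forall>z\<in>U. f z = c + L z)"
  shows "Ck_on k S f"
  using assms
proof (induction k arbitrary: f)
  case 0
  then have "isCont f x" if "x \<in> S" for x
    using affine_near_has_derivative has_derivative_continuous that by metis
  then show ?case
    by (simp add: continuous_at_imp_continuous_on)
next
  case (Suc k)
  have "f differentiable (at x)" if "x \<in> S" for x
    using Suc.prems[OF that] affine_near_has_derivative differentiableI by metis
  moreover have "Ck_on k S (\<lambda>x. frechet_derivative f (at x) v)" for v
  proof (rule Suc.IH)
    fix x assume "x \<in> S"
    then obtain U c L where U: "open U" "x \<in> U" "linear L" "\<And>z. z \<in> U \<Longrightarrow> f z = c + L z"
      using Suc.prems[OF \<open>x \<in> S\<close>] by metis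
    have "frechet_derivative f (at z) v = L v" if "z \<in> U" for z
      by (simp only: frechet_derivative_at[OF affine_near_has_derivative[OF U(1) that U(3,4)], symmetric])
    then show "\<exists>U c L. open U \<and> x \<in> U \<and> linear L \<and> (\<forall>z\<in>U. frechet_derivative f (at z) v = c + L z)"
      using U(1,2) by (intro exI[of _ U] exI[of _ "L v"] exI[of _ "\<lambda>_. 0"]) (simp add: linear_zero)
  qed
  ultimately show ?case by simp
qed

lemma mu_affine_near:
  fixes \<Phi> :: "real^'n^'q" and D :: "real^'p^'n"
  assumes lam: "lam > 0" and y: "y \<notin> restricted_transition_space \<Phi> D lam"
    and x: "is_solution \<Phi> D lam y x" and H: "H_cond \<Phi> D (D_cosupport D x)"
  defines "P \<equiv> \<Phi> ** A_mat \<Phi> D (D_cosupport D x) ** transpose \<Phi>"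
  shows "\<exists>U. open U \<and> y \<in> U \<and> (\<forall>z\<in>U. mu \<Phi> D lam z = (\<Phi> *v x - P *v y) + P *v z)"
proof -
  let ?X = "\<lambda>z. x + A_mat \<Phi> D (D_cosupport D x) *v (transpose \<Phi> *v (z - y))"
  obtain U where U: "open U" "y \<in> U" "\<And>z. z \<in> U \<Longrightarrow> is_solution \<Phi> D lam z (?X z)"
    using solution_near[OF lam y x H] by blast
  have "mu \<Phi> D lam z = (\<Phi> *v x - P *v y) + P *v z" if "z \<in> U" for z
    using mu_eq[OF _ U(3)[OF that]] lam
    by (simp add: P_def matrix_vector_right_distrib matrix_vector_mult_diff_distrib
        flip: matrix_vector_mul_assoc)
  then show ?thesis using U by blast
qed

section \<open>The prediction is smooth off the transition space\<close>

theorem theorem2: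
  fixes \<Phi> :: "real^'n^'q" and D :: "real^'p^'n" and lam :: real
  assumes "Ker \<Phi> \<inter> Ker (transpose D) = {0}"
    and "lam > 0"
  shows "restricted_transition_space \<Phi> D lam \<in> null_sets lebesgue
    \<and> (\<forall>y. y \<notin> restricted_transition_space \<Phi> D lam \<longrightarrow>
          (\<exists>x. is_solution \<Phi> D lam y x \<and> H_cond \<Phi> D (D_cosupport D x)))
    \<and> C_infinity_on (- restricted_transition_space \<Phi> D lam) (mu \<Phi> D lam)
    \<and> (AE y in lebesgue. y \<in> - restricted_transition_space \<Phi> D lam)
    \<and> (\<forall>y. y \<notin> restricted_transition_space \<Phi> D lam \<longrightarrow>
          (\<forall>x. is_solution \<Phi> D lam y x \<and> H_cond \<Phi> D (D_cosupport D x) \<longrightarrow>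
            mu \<Phi> D lam differentiable (at y) \<and>
            jacobian (mu \<Phi> D lam) (at y) =
              \<Phi> ** A_mat \<Phi> D (D_cosupport D x) ** transpose \<Phi>))"
proof (intro conjI allI impI)
  let ?H = "restricted_transition_space \<Phi> D lam"
  have lam0: "0 \<le> lam"
    using assms(2) by simp
  show null: "?H \<in> null_sets lebesgue"
    using closed_negligible_restricted_transition_space(2)[OF lam0]
    by (simp flip: negligible_iff_null_sets)
  show "AE y in lebesgue. y \<in> - ?H"
    using AE_not_in[OF null] by simp
  show sol: "\<exists>x. is_solution \<Phi> D lam y x \<and> H_cond \<Phi> D (D_cosupport D x)" for y
    using H_cond_solution_exists assms .
  show "C_infinity_on (- ?H) (mu \<Phi> D lam)"
    unfolding C_infinity_on_def
  proof (intro conjI allI locally_affine_imp_Ck_on)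
    show "open (- ?H)"
      using closed_negligible_restricted_transition_space(1)[OF lam0]
      by (rule open_Compl)
    show "\<exists>U c L. open U \<and> y \<in> U \<and> linear L \<and> (\<forall>z\<in>U. mu \<Phi> D lam z = c + L z)"
      if "y \<in> - ?H" for y
    proof -
      have y: "y \<notin> ?H"
        using that by simp
      obtain x where x: "is_solution \<Phi> D lam y x" "H_cond \<Phi> D (D_cosupport D x)"
        using sol by blast
      define P where "P = \<Phi> ** A_mat \<Phi> D (D_cosupport D x) ** transpose \<Phi>"
      obtain U where "open U \<and> y \<in> U \<and> (\<forall>z\<in>U. mu \<Phi> D lam z = (\<Phi> *v x - P *v y) + P *v z)"
        using mu_affine_near[OF assms(2) y x] unfolding P_def by (rule exE)
      then show ?thesis
        by (intro exI[of _ U] exI[of _ "\<Phi> *v x - P *v y"] exI[of _ "(*v) P"]) simp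
    qed
  qed
  fix y x
  assume y: "y \<notin> ?H" and x: "is_solution \<Phi> D lam y x \<and> H_cond \<Phi> D (D_cosupport D x)"
  define P where "P = \<Phi> ** A_mat \<Phi> D (D_cosupport D x) ** transpose \<Phi>"
  obtain U where U: "open U \<and> y \<in> U \<and> (\<forall>z\<in>U. mu \<Phi> D lam z = (\<Phi> *v x - P *v y) + P *v z)"
    using mu_affine_near[OF assms(2) y conjunct1[OF x] conjunct2[OF x]] unfolding P_def by (rule exE)
  have deriv: "(mu \<Phi> D lam has_derivative (*v) P) (at y)"
    by (rule affine_near_has_derivative[where U = U and c = "\<Phi> *v x - P *v y", OF _ _ matrix_vector_mul_linear])
       (use U in simp_all)
  then show "mu \<Phi> D lam differentiable (at y)"
    by (rule differentiableI)
  show "jacobian (mu \<Phi> D lam) (at y) = \<Phi> ** A_mat \<Phi> D (D_cosupport D x) ** transpose \<Phi>"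
    by (simp only: jacobian_def frechet_derivative_at[OF deriv, symmetric]
        matrix_of_matrix_vector_mul P_def)
qed

end
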